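(* There is an algorithm that, given a subgraph $G$ of the $n\times n$ knight's graph $K_n$ (with $n \ge 4$, $G$ given as an adjacency list), computes the set of all rails in $G$ in $O(n^2)$ time.
   Context: For $n \in \mathbb{N}$, the knight's graph $K_n$ is the undirected graph whose vertices are the $n^2$ cells of an $n\times n$ chessboard, with an edge between two cells iff a chess knight can move from one to the other (column and row displacements $(\pm1,\pm2)$ or $(\pm2,\pm1)$). For cells $u,v$ joined by a knight move, let $\mathrm{km}(u,v)$ denote the knight move (displacement vector) taking $u$ to $v$. A rail in a subgraph $G$ of $K_n$ is an unordered pair of edges $(e,e')$ of $G$ with $e=(v_0,v_1)$, $e'=(v_2,v_3)$, such that $\mathrm{km}(v_0,v_1)=\mathrm{km}(v_2,v_3)$, $\mathrm{km}(v_0,v_2)=\mathrm{km}(v_1,v_3)$, and $(v_0,v_2)$, $(v_1,v_3)$ are edges of $K_n$ that are not edges of $G$. *)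

theory Defs
  imports Complex_Main "HOL-Library.Landau_Symbols"
begin

section \<open>The knight's graph, subgraphs and rails\<close>

text \<open>An undirected graph is a pair of a vertex set and a set of edges \<open>{u, v}\<close>.\<close>

type_synonym 'a ugraph = "'a set \<times> 'a set set"

abbreviation verts :: "'a ugraph \<Rightarrow> 'a set" where "verts G \<equiv> fst G"

abbreviation edges :: "'a ugraph \<Rightarrow> 'a set set" where "edges G \<equiv> snd G"

definition subgraph :: "'a ugraph \<Rightarrow> 'a ugraph \<Rightarrow> bool" where
  "subgraph G H \<longleftrightarrow>
     verts G \<subseteq> verts H \<and> edges G \<subseteq> edges H \<and> (\<forall>e\<in>edges G. e \<subseteq> verts G)"

text \<open>A cell is a pair of column and row, both counted from 0.\<close>

type_synonym cell = "nat \<times> nat"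

definition cells :: "nat \<Rightarrow> cell set" where
  "cells n = {..<n} \<times> {..<n}"

definition km :: "cell \<Rightarrow> cell \<Rightarrow> int \<times> int" where
  "km u v = (int (fst v) - int (fst u), int (snd v) - int (snd u))"

definition knight_moves :: "(int \<times> int) set" where
  "knight_moves = {(1, 2), (1, -2), (-1, 2), (-1, -2), (2, 1), (2, -1), (-2, 1), (-2, -1)}"

definition knight_graph :: "nat \<Rightarrow> cell ugraph" where
  "knight_graph n =
     (cells n, {{u, v} | u v. u \<in> cells n \<and> v \<in> cells n \<and> km u v \<in> knight_moves})"

text \<open>The pair of edges is unordered, as are the edges, so a rail is a set of two sets of
  two cells. That the four cells are distinct follows from the conditions.\<close>

definition rails :: "nat \<Rightarrow> cell ugraph \<Rightarrow> cell set set set" where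
  "rails n G = {{{v0, v1}, {v2, v3}} | v0 v1 v2 v3.
     {v0, v1} \<in> edges G \<and> {v2, v3} \<in> edges G \<and>
     km v0 v1 = km v2 v3 \<and> km v0 v2 = km v1 v3 \<and>
     {v0, v2} \<in> edges (knight_graph n) - edges G \<and>
     {v1, v3} \<in> edges (knight_graph n) - edges G}"


section \<open>A word RAM with unit cost\<close>

text \<open>Programs run on a random access machine with words of \<open>w\<close> bits: registers, memory cells and
  addresses hold natural numbers below \<open>2 ^ w\<close>. Addition and multiplication are modulo \<open>2 ^ w\<close>,
  subtraction is truncated at 0. Results are written word by word to an output tape.
  A program is a fixed piece of syntax that depends neither on the input nor on \<open>w\<close>.\<close>

datatype binop = Add | Sub | Mul

datatype aexp = Const nat | Reg nat | Load aexp | Bin binop aexp aexp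

datatype bexp = Less aexp aexp | Equal aexp aexp | Neg bexp | Conj bexp bexp

datatype com =
    Skip
  | Assign nat aexp
  | Store aexp aexp  \<comment> \<open>address, value\<close>
  | Emit aexp
  | Seq com com
  | If bexp com com
  | While bexp com

record state =
  regs :: "nat \<Rightarrow> nat"
  mem :: "nat \<Rightarrow> nat"
  out :: "nat list"

fun binop_val :: "nat \<Rightarrow> binop \<Rightarrow> nat \<Rightarrow> nat \<Rightarrow> nat" where
  "binop_val w Add x y = (x + y) mod 2 ^ w"
| "binop_val w Sub x y = x - y"
| "binop_val w Mul x y = (x * y) mod 2 ^ w"

fun aval :: "nat \<Rightarrow> aexp \<Rightarrow> state \<Rightarrow> nat" where
  "aval w (Const k) s = k mod 2 ^ w"
| "aval w (Reg r) s = regs s r"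
| "aval w (Load a) s = mem s (aval w a s)"
| "aval w (Bin f a b) s = binop_val w f (aval w a s) (aval w b s)"

fun bval :: "nat \<Rightarrow> bexp \<Rightarrow> state \<Rightarrow> bool" where
  "bval w (Less a b) s \<longleftrightarrow> aval w a s < aval w b s"
| "bval w (Equal a b) s \<longleftrightarrow> aval w a s = aval w b s"
| "bval w (Neg b) s \<longleftrightarrow> \<not> bval w b s"
| "bval w (Conj b c) s \<longleftrightarrow> bval w b s \<and> bval w c s"

text \<open>Every operand, operator and memory access of an expression costs one unit.\<close>

fun acost :: "aexp \<Rightarrow> nat" where
  "acost (Const k) = 1"
| "acost (Reg r) = 1"
| "acost (Load a) = 1 + acost a"
| "acost (Bin f a b) = 1 + acost a + acost b"

fun bcost :: "bexp \<Rightarrow> nat" where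
  "bcost (Less a b) = 1 + acost a + acost b"
| "bcost (Equal a b) = 1 + acost a + acost b"
| "bcost (Neg b) = 1 + bcost b"
| "bcost (Conj b c) = 1 + bcost b + bcost c"

text \<open>\<open>exec w c s t s'\<close>: with words of \<open>w\<close> bits, the program \<open>c\<close> started in \<open>s\<close> halts in \<open>s'\<close>
  after \<open>t\<close> time units.\<close>

inductive exec :: "nat \<Rightarrow> com \<Rightarrow> state \<Rightarrow> nat \<Rightarrow> state \<Rightarrow> bool" for w :: nat where
  Skip: "exec w Skip s 1 s"
| Assign: "exec w (Assign r a) s (1 + acost a) (s\<lparr>regs := (regs s)(r := aval w a s)\<rparr>)"
| Store: "exec w (Store a b) s (1 + acost a + acost b)
            (s\<lparr>mem := (mem s)(aval w a s := aval w b s)\<rparr>)"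
| Emit: "exec w (Emit a) s (1 + acost a) (s\<lparr>out := out s @ [aval w a s]\<rparr>)"
| Seq: "exec w c1 s t1 s1 \<Longrightarrow> exec w c2 s1 t2 s2 \<Longrightarrow> exec w (Seq c1 c2) s (t1 + t2) s2"
| IfTrue: "bval w b s \<Longrightarrow> exec w c1 s t s1 \<Longrightarrow> exec w (If b c1 c2) s (1 + bcost b + t) s1"
| IfFalse: "\<not> bval w b s \<Longrightarrow> exec w c2 s t s1 \<Longrightarrow> exec w (If b c1 c2) s (1 + bcost b + t) s1"
| WhileFalse: "\<not> bval w b s \<Longrightarrow> exec w (While b c) s (1 + bcost b) s"
| WhileTrue: "bval w b s \<Longrightarrow> exec w c s t1 s1 \<Longrightarrow> exec w (While b c) s1 t2 s2 \<Longrightarrow>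
    exec w (While b c) s (1 + bcost b + t1 + t2) s2"

inductive_cases SkipE: "exec w Skip s t s'"
inductive_cases AssignE: "exec w (Assign r a) s t s'"
inductive_cases StoreE: "exec w (Store a b) s t s'"
inductive_cases EmitE: "exec w (Emit a) s t s'"
inductive_cases SeqE: "exec w (Seq c1 c2) s t s'"
inductive_cases IfE: "exec w (If b c1 c2) s t s'"
inductive_cases WhileE: "exec w (While b c) s t s'"

lemma exec_deterministic:
  "exec w c s t s1 \<Longrightarrow> exec w c s u s2 \<Longrightarrow> u = t \<and> s2 = s1"
proof (induction arbitrary: u s2 rule: exec.induct)
  case (Seq c1 s t1 s1 c2 t2 s2')
  from Seq.prems show ?case by (rule SeqE) (metis Seq.IH)
next
  case (IfTrue b s c1 t s1 c2)
  from IfTrue.prems show ?case by (rule IfE) (use IfTrue.IH IfTrue.hyps(1) in \<open>auto\<close>)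
next
  case (IfFalse b s c2 t s1 c1)
  from IfFalse.prems show ?case by (rule IfE) (use IfFalse.IH IfFalse.hyps(1) in \<open>auto\<close>)
next
  case (WhileFalse b s c)
  from WhileFalse.prems show ?case by (rule WhileE) (use WhileFalse.hyps in simp_all)
next
  case (WhileTrue b s c t1 s1 t2 s2')
  from WhileTrue.prems show ?case by (rule WhileE) (use WhileTrue.hyps(1) in simp, metis WhileTrue.IH plus_1_eq_Suc add_Suc)
next
  case Skip then show ?case by (rule SkipE) simp
next
  case Assign then show ?case by (rule AssignE) simp
next
  case Store then show ?case by (rule StoreE) simp
next
  case Emit then show ?case by (rule EmitE) simp
qed

definition word_state :: "nat \<Rightarrow> state \<Rightarrow> bool" where
  "word_state w s \<longleftrightarrow> (\<forall>r. regs s r < 2 ^ w) \<and> (\<forall>a. mem s a < 2 ^ w)"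


section \<open>Input and output conventions\<close>

text \<open>Cells are numbered row by row.\<close>

definition cell_index :: "nat \<Rightarrow> cell \<Rightarrow> nat" where
  "cell_index n v = snd v * n + fst v"

text \<open>Singly linked lists: a node at address \<open>p\<close> holds its entry at \<open>p\<close> and the address of the next
  node at \<open>p + 1\<close>; 0 is the null pointer.\<close>

fun linked_list :: "nat \<Rightarrow> (nat \<Rightarrow> nat) \<Rightarrow> nat \<Rightarrow> nat list \<Rightarrow> bool" where
  "linked_list w m p [] \<longleftrightarrow> p = 0"
| "linked_list w m p (x # xs) \<longleftrightarrow>
     p \<noteq> 0 \<and> p + 1 < 2 ^ w \<and> m p = x \<and> linked_list w m (m (p + 1)) xs"

text \<open>The adjacency list of a graph on cells of the \<open>n \<times> n\<close> board, stored from address \<open>b\<close> on: an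
  array with one list head per cell, in the order of the cell numbers. The lists enumerate the
  neighbours in an arbitrary order; cells that are not vertices of \<open>G\<close> have the empty list.\<close>

definition adjacency_list ::
    "nat \<Rightarrow> nat \<Rightarrow> cell ugraph \<Rightarrow> (nat \<Rightarrow> nat) \<Rightarrow> nat \<Rightarrow> bool" where
  "adjacency_list w n G m b \<longleftrightarrow>
     b + n\<^sup>2 \<le> 2 ^ w \<and>
     (\<forall>v\<in>cells n. \<exists>us. distinct us \<and> set us = {u. {v, u} \<in> edges G} \<and>
        linked_list w m (m (b + cell_index n v)) (map (cell_index n) us))"

text \<open>Register 0 holds \<open>n\<close> and register 1 the address of the adjacency list. All other registers
  and memory cells are arbitrary.\<close>

definition input_state :: "nat \<Rightarrow> nat \<Rightarrow> cell ugraph \<Rightarrow> state \<Rightarrow> bool" where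
  "input_state w n G s \<longleftrightarrow>
     word_state w s \<and> regs s 0 = n \<and> adjacency_list w n G (mem s) (regs s 1) \<and> out s = []"

text \<open>A set of rails is output as an enumeration without repetitions, every rail
  \<open>{{v0, v1}, {v2, v3}}\<close> as four consecutive cell numbers.\<close>

fun rail_of :: "cell \<times> cell \<times> cell \<times> cell \<Rightarrow> cell set set" where
  "rail_of (v0, v1, v2, v3) = {{v0, v1}, {v2, v3}}"

fun rail_words :: "nat \<Rightarrow> cell \<times> cell \<times> cell \<times> cell \<Rightarrow> nat list" where
  "rail_words n (v0, v1, v2, v3) = map (cell_index n) [v0, v1, v2, v3]"

definition encodes_rails :: "nat \<Rightarrow> nat list \<Rightarrow> cell set set set \<Rightarrow> bool" where
  "encodes_rails n xs R \<longleftrightarrow>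
     (\<exists>rs. distinct (map rail_of rs) \<and> set (map rail_of rs) = R \<and>
           xs = concat (map (rail_words n) rs))"

end

theory Submission
  imports Defs "HOL-Library.Product_Plus"
begin

text \<open>A rail is a parallelogram \<open>v, v + d, v + e, v + d + e\<close> with knight moves \<open>d\<close> and \<open>e\<close>. It has four
  such descriptions, since \<open>d\<close> and \<open>e\<close> can be reversed independently, and exactly one in which both
  moves go to the right. So it suffices to try, for every cell \<open>v\<close>, the 16 pairs of moves to the right.
  Degrees are at most 8, so each adjacency test walks a list of bounded length. The program never
  writes to memory.\<close>

section \<open>Timed total correctness\<close>

text \<open>A total-correctness triple anchored at one start state. Time is only bounded from above,
  so branches of unequal cost and loops that stop early can share a bound.\<close>

definition runs :: "nat \<Rightarrow> com \<Rightarrow> state \<Rightarrow> nat \<Rightarrow> (state \<Rightarrow> bool) \<Rightarrow> bool" where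
  "runs w c s T Q \<longleftrightarrow> (\<exists>t s'. exec w c s t s' \<and> t \<le> T \<and> Q s')"

lemma runs_mono:
  "runs w c s T Q \<Longrightarrow> T \<le> T' \<Longrightarrow> (\<And>s'. Q s' \<Longrightarrow> Q' s') \<Longrightarrow> runs w c s T' Q'"
  unfolding runs_def by (meson le_trans)

lemma runs_Skip: "Q s \<Longrightarrow> runs w Skip s 1 Q"
  unfolding runs_def by (meson exec.Skip order_refl)

lemma runs_Assign:
  "Q (s\<lparr>regs := (regs s)(r := aval w a s)\<rparr>) \<Longrightarrow> runs w (Assign r a) s (1 + acost a) Q"
  unfolding runs_def by (blast intro: exec.Assign)

lemma runs_Emit:
  "Q (s\<lparr>out := out s @ [aval w a s]\<rparr>) \<Longrightarrow> runs w (Emit a) s (1 + acost a) Q"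
  unfolding runs_def by (blast intro: exec.Emit)

text \<open>The claim about \<open>c2\<close> serves as postcondition of \<open>c1\<close>, in
  weakest-precondition style, so no intermediate assertion has to be named.\<close>

lemma runs_Seq:
  "runs w c1 s T1 (\<lambda>s1. runs w c2 s1 T2 Q) \<Longrightarrow> runs w (Seq c1 c2) s (T1 + T2) Q"
  unfolding runs_def by (meson exec.Seq add_mono)

lemma runs_If:
  "(bval w b s \<Longrightarrow> runs w c1 s T Q) \<Longrightarrow> (\<not> bval w b s \<Longrightarrow> runs w c2 s T Q) \<Longrightarrow>
   runs w (If b c1 c2) s (1 + bcost b + T) Q"
  unfolding runs_def by (cases "bval w b s") (meson exec.IfTrue exec.IfFalse add_left_mono)+

lemma runs_WhileFalse: "\<not> bval w b s \<Longrightarrow> Q s \<Longrightarrow> runs w (While b c) s (1 + bcost b) Q"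
  unfolding runs_def by (meson exec.WhileFalse order_refl)

lemma runs_WhileTrue:
  "bval w b s \<Longrightarrow> runs w c s T1 (\<lambda>s1. runs w (While b c) s1 T2 Q) \<Longrightarrow>
   runs w (While b c) s (1 + bcost b + T1 + T2) Q"
  unfolding runs_def by (meson exec.WhileTrue add_mono order_refl)

text \<open>Rule for counting loops: the invariant is indexed by the counter. Each of the
  \<open>N - i\<close> rounds pays for guard and body; the last summand is the failing guard
  test.\<close>

lemma runs_count_up:
  assumes guard: "\<And>i s. I i s \<Longrightarrow> bval w b s \<longleftrightarrow> i < N"
    and body: "\<And>i s. i < N \<Longrightarrow> I i s \<Longrightarrow> runs w c s T (I (Suc i))"
    and "i \<le> N" "I i s"
  shows "runs w (While b c) s ((N - i) * (1 + bcost b + T) + (1 + bcost b)) (I N)"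
  using assms(3,4)
proof (induction "N - i" arbitrary: i s)
  case 0
  then show ?case using guard[of i s] runs_WhileFalse by auto
next
  case (Suc k)
  then have i: "i < N" and k: "k = N - Suc i" by auto
  have "runs w (While b c) s
      (1 + bcost b + T + ((N - Suc i) * (1 + bcost b + T) + (1 + bcost b))) (I N)"
  proof (rule runs_WhileTrue)
    show "bval w b s" using guard Suc.prems i by auto
    show "runs w c s T (\<lambda>s1. runs w (While b c) s1
        ((N - Suc i) * (1 + bcost b + T) + (1 + bcost b)) (I N))"
      using body[OF i Suc.prems(2)] by (rule runs_mono) (use Suc.hyps(1)[OF k] i in auto)
  qed
  then show ?case
    by (rule runs_mono) (use Suc.hyps(2) k in \<open>auto simp flip: Suc.hyps(2)\<close>)
qed

fun seqs :: "com list \<Rightarrow> com" where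
  "seqs [] = Skip"
| "seqs (c # cs) = Seq c (seqs cs)"

text \<open>Rule for an unrolled loop: the invariant is indexed by a list that grows by
  \<open>f x\<close> at each command. The extra unit of time is the final
  \<open>Skip\<close>.\<close>

lemma runs_seqs:
  assumes "\<And>x ys s. x \<in> set xs \<Longrightarrow> I ys s \<Longrightarrow> runs w (c x) s T (I (ys @ f x))"
    and "I ys s"
  shows "runs w (seqs (map c xs)) s (length xs * T + 1) (I (ys @ concat (map f xs)))"
  using assms
proof (induction xs arbitrary: ys s)
  case Nil
  then show ?case using runs_Skip[of "I ys"] by simp
next
  case (Cons x xs)
  have "runs w (c x) s T (\<lambda>s1. runs w (seqs (map c xs)) s1 (length xs * T + 1)
      (I (ys @ concat (map f (x # xs)))))"
    using Cons.prems(1)[OF _ Cons.prems(2), of x]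
    by (rule runs_mono) (use Cons.IH[of "ys @ f x"] Cons.prems(1) in auto)
  then show ?case by (auto dest: runs_Seq simp: algebra_simps)
qed


section \<open>Rails as displaced parallelograms\<close>

text \<open>\<open>nat\<close> cuts negative coordinates off at 0, so the result is the displaced
  cell only under \<open>in_board\<close>.\<close>

definition shift :: "cell \<Rightarrow> int \<times> int \<Rightarrow> cell" where
  "shift v d = (nat (int (fst v) + fst d), nat (int (snd v) + snd d))"

definition in_board :: "nat \<Rightarrow> cell \<Rightarrow> int \<times> int \<Rightarrow> bool" where
  "in_board n v d \<longleftrightarrow>
     0 \<le> int (fst v) + fst d \<and> int (fst v) + fst d < int n \<and>
     0 \<le> int (snd v) + snd d \<and> int (snd v) + snd d < int n"

definition right_moves :: "(int \<times> int) list" where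
  "right_moves = [(1, 2), (1, -2), (2, 1), (2, -1)]"

text \<open>The first move of \<open>p\<close> runs along the two edges of the rail, the second
  leads from one edge to the other. The order of the corners is that of
  \<open>rail_of\<close>.\<close>

definition parallelogram :: "cell \<Rightarrow> (int \<times> int) \<times> (int \<times> int) \<Rightarrow> cell \<times> cell \<times> cell \<times> cell" where
  "parallelogram v p =
     (v, shift v (fst p), shift v (snd p), shift v (fst p + snd p))"

definition spans_rail :: "nat \<Rightarrow> cell ugraph \<Rightarrow> cell \<Rightarrow> (int \<times> int) \<times> (int \<times> int) \<Rightarrow> bool" where
  "spans_rail n G v p \<longleftrightarrow>
     in_board n v (fst p) \<and> in_board n v (snd p) \<and> in_board n v (fst p + snd p) \<and>
     {v, shift v (fst p)} \<in> edges G \<and> {shift v (snd p), shift v (fst p + snd p)} \<in> edges G \<and>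
     {v, shift v (snd p)} \<notin> edges G \<and> {shift v (fst p), shift v (fst p + snd p)} \<notin> edges G"

definition move_pairs :: "((int \<times> int) \<times> (int \<times> int)) list" where
  "move_pairs = List.product right_moves right_moves"

lemma shift_zero [simp]: "shift v 0 = v"
  by (simp add: shift_def)

lemma in_board_zero: "in_board n v 0 \<longleftrightarrow> v \<in> cells n"
  by (cases v) (simp add: in_board_def cells_def)

lemma shift_in_cells: "in_board n v d \<Longrightarrow> shift v d \<in> cells n"
  by (auto simp: in_board_def shift_def cells_def)

lemma km_shift_shift:
  "in_board n v d \<Longrightarrow> in_board n v e \<Longrightarrow> km (shift v d) (shift v e) = e - d"
  by (auto simp: in_board_def shift_def km_def prod_eq_iff)

lemma km_shift: "in_board n v d \<Longrightarrow> km v (shift v d) = d"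
  by (auto simp: in_board_def shift_def km_def)

lemma shift_km: "shift v (km v u) = u"
  by (simp add: shift_def km_def)

lemma in_board_km: "u \<in> cells n \<Longrightarrow> in_board n v (km v u)"
  by (auto simp: in_board_def km_def cells_def)

lemma right_moves_knight: "d \<in> set right_moves \<Longrightarrow> d \<in> knight_moves"
  by (auto simp: right_moves_def knight_moves_def)

lemma right_moves_pos: "d \<in> set right_moves \<Longrightarrow> 0 < fst d"
  by (auto simp: right_moves_def)

lemma km_minus: "km v u = - km u v"
  by (simp add: km_def prod_eq_iff)

lemma knight_moves_right:
  "km u v \<in> knight_moves \<Longrightarrow> km u v \<in> set right_moves \<or> km v u \<in> set right_moves"
  unfolding km_minus[of v u] by (auto simp: right_moves_def knight_moves_def)

lemma km_sym: "km u v \<in> knight_moves \<longleftrightarrow> km v u \<in> knight_moves"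
proof -
  have "- d \<in> knight_moves" if "d \<in> knight_moves" for d
    using that by (auto simp: knight_moves_def)
  then show ?thesis by (metis km_minus)
qed

lemma km_swap: "km u v = km x y \<Longrightarrow> km v u = km y x"
  by (metis km_minus)

lemma edge_knight_graph:
  "{u, v} \<in> edges (knight_graph n) \<longleftrightarrow> u \<in> cells n \<and> v \<in> cells n \<and> km u v \<in> knight_moves"
  unfolding knight_graph_def snd_conv mem_Collect_eq doubleton_eq_iff using km_sym by blast

text \<open>Of a knight move and its opposite, one goes to the right. Reversing both edges negates
  one move of the parallelogram, exchanging the two edges negates the other, and neither changes the
  unordered rail.\<close>

lemma rails_eq:
  assumes G: "subgraph G (knight_graph n)"
  shows "rails n G = (\<lambda>(v, p). rail_of (parallelogram v p)) `
    {(v, p). v \<in> cells n \<and> p \<in> set move_pairs \<and> spans_rail n G v p}"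
    (is "_ = ?f ` ?S")
proof
  have edge: "u \<in> cells n \<and> v \<in> cells n \<and> km u v \<in> knight_moves" if "{u, v} \<in> edges G" for u v
    using that G edge_knight_graph unfolding subgraph_def by blast
  define R where "R v0 v1 v2 v3 \<longleftrightarrow>
     {v0, v1} \<in> edges G \<and> {v2, v3} \<in> edges G \<and>
     km v0 v1 = km v2 v3 \<and> km v0 v2 = km v1 v3 \<and>
     {v0, v2} \<in> edges (knight_graph n) - edges G \<and>
     {v1, v3} \<in> edges (knight_graph n) - edges G" for v0 v1 v2 v3
  \<comment> \<open>The two symmetries: the first reverses both edges, the second exchanges
    them.\<close>
  have R_flip: "R v1 v0 v3 v2" "R v2 v3 v0 v1" if "R v0 v1 v2 v3" for v0 v1 v2 v3
    using that km_swap[of v0 v1 v2 v3] km_swap[of v0 v2 v1 v3] unfolding R_def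
    by (simp_all add: insert_commute)
  show "rails n G \<subseteq> ?f ` ?S"
  proof
    fix r assume "r \<in> rails n G"
    then obtain a0 a1 a2 a3 where a: "R a0 a1 a2 a3" "r = {{a0, a1}, {a2, a3}}"
      unfolding rails_def R_def by blast
    have "km a0 a1 \<in> set right_moves \<or> km a1 a0 \<in> set right_moves"
      using a edge knight_moves_right unfolding R_def by blast
    then obtain b0 b1 b2 b3 where
      b: "R b0 b1 b2 b3" "r = {{b0, b1}, {b2, b3}}" "km b0 b1 \<in> set right_moves"
    proof
      assume "km a1 a0 \<in> set right_moves"
      then show ?thesis using that[OF R_flip(1)[OF a(1)]] a(2) by (simp add: insert_commute)
    qed (use a that in blast)
    have "km b0 b2 \<in> set right_moves \<or> km b2 b0 \<in> set right_moves"
      using b(1) edge_knight_graph knight_moves_right unfolding R_def by blast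
    then obtain c0 c1 c2 c3 where
      c: "R c0 c1 c2 c3" "r = {{c0, c1}, {c2, c3}}"
        "km c0 c1 \<in> set right_moves" "km c0 c2 \<in> set right_moves"
    proof
      assume "km b2 b0 \<in> set right_moves"
      \<comment> \<open>Both edges have the same displacement, so exchanging them preserves the
        direction already normalised.\<close>
      moreover have "km b2 b3 \<in> set right_moves"
        using b(1,3) unfolding R_def by simp
      ultimately show ?thesis
        using that[OF R_flip(2)[OF b(1)]] b(2) by (simp add: insert_commute)
    qed (use b that in blast)
    have cells: "c0 \<in> cells n" "c1 \<in> cells n" "c2 \<in> cells n" "c3 \<in> cells n"
      using c(1) edge unfolding R_def by blast+
    have edges: "{c0, c1} \<in> edges G" "{c2, c3} \<in> edges G"
        "{c0, c2} \<notin> edges G" "{c1, c3} \<notin> edges G"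
      using c(1) unfolding R_def by blast+
    \<comment> \<open>Since \<open>km c0 c2 = km c1 c3\<close>, the sum is the displacement along
      \<open>c0\<close>, \<open>c1\<close>, \<open>c3\<close>.\<close>
    have sum: "km c0 c1 + km c0 c2 = km c0 c3"
      using c(1) unfolding R_def by (simp add: km_def)
    have "(c0, km c0 c1, km c0 c2) \<in> ?S"
      using cells c(3,4) edges
      by (simp add: spans_rail_def move_pairs_def in_board_km shift_km sum)
    moreover have "?f (c0, km c0 c1, km c0 c2) = r"
      using c(2) by (simp add: parallelogram_def shift_km sum)
    ultimately show "r \<in> ?f ` ?S" by blast
  qed
  show "?f ` ?S \<subseteq> rails n G"
  proof clarify
    fix v d e
    assume v: "v \<in> cells n" and de: "(d, e) \<in> set move_pairs" and s: "spans_rail n G v (d, e)"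
    \<comment> \<open>The sides along \<open>d\<close> are edges of \<open>G\<close> by
      \<open>spans_rail\<close>; the sides along \<open>e\<close> still have to be recognised as
      edges of the knight's graph.\<close>
    have "e \<in> knight_moves"
      using de right_moves_knight by (auto simp: move_pairs_def)
    then have "R v (shift v d) (shift v e) (shift v (d + e))"
      using s v unfolding R_def spans_rail_def
      by (auto simp: edge_knight_graph km_shift km_shift_shift shift_in_cells)
    then show "rail_of (parallelogram v (d, e)) \<in> rails n G"
      unfolding rails_def R_def parallelogram_def fst_conv snd_conv rail_of.simps by blast
  qed
qed

text \<open>Both moves go to the right, so columns tell the ends of each edge and the two edges apart.\<close>

lemma inj_rail_of_parallelogram:
  "inj_on (\<lambda>(v, p). rail_of (parallelogram v p))
     {(v, p). v \<in> cells n \<and> p \<in> set move_pairs \<and> spans_rail n G v p}"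
  (is "inj_on ?f ?S")
proof (rule inj_onI)
  fix x y assume xy: "x \<in> ?S" "y \<in> ?S" "?f x = ?f y"
  obtain v d e u d' e' where x: "x = (v, d, e)" and y: "y = (u, d', e')"
    by (cases x, cases y) auto
  have eq: "rail_of (parallelogram v (d, e)) = rail_of (parallelogram u (d', e'))"
    and D: "(d, e) \<in> set move_pairs" "(d', e') \<in> set move_pairs"
    and sp: "spans_rail n G v (d, e)" "spans_rail n G u (d', e')"
    using xy by (simp_all add: x y)
  have pos: "0 < fst d" "0 < fst e" "0 < fst d'" "0 < fst e'"
    using D right_moves_pos by (auto simp: move_pairs_def)
  have cols: "fst x < fst (shift x a)" "fst x < fst (shift x b)"
      "fst (shift x a) < fst (shift x (a + b))" "fst (shift x b) < fst (shift x (a + b))"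
    if "0 < fst a" "0 < fst b" for x :: cell and a b :: "int \<times> int"
    using that by (auto simp: shift_def)
  have "v = u \<and> shift v d = shift u d' \<and> shift v e = shift u e'"
    using eq cols[OF pos(1,2), of v] cols[OF pos(3,4), of u]
    by (auto simp: parallelogram_def doubleton_eq_iff)
  \<comment> \<open>On the board nothing is cut off, so \<open>km\<close> recovers a move from its
    two end cells.\<close>
  moreover from this have "d = d'" "e = e'"
    using sp km_shift unfolding spans_rail_def by (metis fst_conv snd_conv)+
  ultimately show "x = y" by (simp add: x y)
qed


section \<open>The program\<close>

text \<open>Registers 2 and 3 hold the column and the row of the current cell.\<close>

definition coord :: "nat \<Rightarrow> int \<Rightarrow> aexp" where
  "coord r z = (if 0 \<le> z then Bin Add (Reg r) (Const (nat z))
                else Bin Sub (Reg r) (Const (nat (- z))))"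

text \<open>A nonnegative displacement can only exceed the upper border, a negative one only the
  lower. Truncated subtraction would hide the latter, so the register itself is compared with
  \<open>- z\<close>.\<close>

definition coord_ok :: "nat \<Rightarrow> int \<Rightarrow> bexp" where
  "coord_ok r z = (if 0 \<le> z then Less (coord r z) (Reg 0)
                   else Neg (Less (Reg r) (Const (nat (- z)))))"

definition cell_ok :: "int \<times> int \<Rightarrow> bexp" where
  "cell_ok d = Conj (coord_ok 2 (fst d)) (coord_ok 3 (snd d))"

definition cell_exp :: "int \<times> int \<Rightarrow> aexp" where
  "cell_exp d = Bin Add (Bin Mul (coord 3 (snd d)) (Reg 0)) (coord 2 (fst d))"

text \<open>Afterwards register \<open>r\<close> is the null pointer iff the two displaced cells are not adjacent.\<close>

definition search :: "nat \<Rightarrow> int \<times> int \<Rightarrow> int \<times> int \<Rightarrow> com" where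
  "search r d e =
     Seq (Assign r (Load (Bin Add (Reg 1) (cell_exp d))))
         (While (Conj (Neg (Equal (Reg r) (Const 0))) (Neg (Equal (Load (Reg r)) (cell_exp e))))
            (Assign r (Load (Bin Add (Reg r) (Const 1)))))"

text \<open>Registers 4 and 5 test the two sides along \<open>d\<close>, which must be edges;
  registers 6 and 7 test the sides along \<open>e\<close>, which must not be.\<close>

definition try_pair :: "(int \<times> int) \<times> (int \<times> int) \<Rightarrow> com" where
  "try_pair p = (let d = fst p; e = snd p in
     If (Conj (cell_ok d) (Conj (cell_ok e) (cell_ok (d + e))))
       (Seq (search 4 0 d) (Seq (search 5 e (d + e)) (Seq (search 6 0 e) (Seq (search 7 d (d + e))
         (If (Conj (Conj (Neg (Equal (Reg 4) (Const 0))) (Neg (Equal (Reg 5) (Const 0))))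
                   (Conj (Equal (Reg 6) (Const 0)) (Equal (Reg 7) (Const 0))))
           (Seq (Emit (cell_exp 0)) (Seq (Emit (cell_exp d))
             (Seq (Emit (cell_exp e)) (Emit (cell_exp (d + e))))))
           Skip)))))
       Skip)"

text \<open>The moves are constants in the program text, so the 16 pairs are unrolled instead of
  looped over.\<close>

definition visit_cell :: com where
  "visit_cell = seqs (map try_pair move_pairs)"

definition visit_row :: com where
  "visit_row = Seq (Assign 2 (Const 0)) (While (Less (Reg 2) (Reg 0))
     (Seq visit_cell (Assign 2 (Bin Add (Reg 2) (Const 1)))))"

definition rail_finder :: com where
  "rail_finder = Seq (Assign 3 (Const 0)) (While (Less (Reg 3) (Reg 0))
     (Seq visit_row (Assign 3 (Bin Add (Reg 3) (Const 1)))))"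

lemma acost_cell_exp [simp]: "acost (cell_exp d) = 9"
  by (simp add: cell_exp_def coord_def)

lemma bcost_cell_ok: "bcost (cell_ok d) \<le> 11"
  by (simp add: cell_ok_def coord_ok_def coord_def)

section \<open>Word arithmetic on board coordinates\<close>

locale rail_input =
  fixes w n :: nat and G :: "cell ugraph" and m :: "nat \<Rightarrow> nat" and b :: nat
  assumes n: "4 \<le> n" and G: "subgraph G (knight_graph n)" and w: "4 * n\<^sup>2 \<le> 2 ^ w"
    and adj: "adjacency_list w n G m b"
begin

definition env :: "state \<Rightarrow> bool" where
  "env s \<longleftrightarrow> mem s = m \<and> regs s 0 = n \<and> regs s 1 = b"

definition visiting :: "cell \<Rightarrow> state \<Rightarrow> bool" where
  "visiting v s \<longleftrightarrow> env s \<and> regs s 2 = fst v \<and> regs s 3 = snd v \<and> v \<in> cells n"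

text \<open>Coordinates of \<open>d + e\<close> are at most 4 in absolute value, so the bound on
  \<open>n + 4\<close> keeps displaced coordinates from wrapping around.\<close>

lemma word_bounds: "n\<^sup>2 < 2 ^ w" "n + 4 < 2 ^ w" "8 < (2::nat) ^ w" "0 < w"
proof -
  have "4 * n \<le> n\<^sup>2" using n by (simp add: power2_eq_square)
  then show "n\<^sup>2 < 2 ^ w" "n + 4 < 2 ^ w" "8 < (2::nat) ^ w" using n w by linarith+
  then show "0 < w" by (cases w) auto
qed

lemma cell_index_less:
  assumes "v \<in> cells n" shows "cell_index n v < n\<^sup>2"
proof -
  have "snd v * n + fst v < (snd v + 1) * n" using assms by (auto simp: cells_def)
  also have "\<dots> \<le> n * n" using assms by (intro mult_right_mono) (auto simp: cells_def)
  finally show ?thesis by (simp add: cell_index_def power2_eq_square)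
qed

lemma inj_cell_index: "inj_on (cell_index n) (cells n)"
proof (rule inj_onI)
  fix u v assume *: "u \<in> cells n" "v \<in> cells n" "cell_index n u = cell_index n v"
  have "cell_index n x mod n = fst x" "cell_index n x div n = snd x" if "x \<in> cells n" for x
    using that by (auto simp: cell_index_def cells_def)
  then show "u = v" using * by (metis prod_eqI)
qed

lemma coord_ok:
  assumes "regs s r < n" "regs s 0 = n" "\<bar>z\<bar> \<le> 4"
  shows "bval w (coord_ok r z) s \<longleftrightarrow> 0 \<le> int (regs s r) + z \<and> int (regs s r) + z < int n"
proof -
  have "nat \<bar>z\<bar> < 2 ^ w" "regs s r + nat \<bar>z\<bar> < 2 ^ w"
    using assms word_bounds(2) by linarith+
  then show ?thesis using assms(1,2) by (auto simp: coord_ok_def coord_def)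
qed

lemma aval_coord:
  assumes "regs s r < n" "\<bar>z\<bar> \<le> 4"
  shows "aval w (coord r z) s = nat (int (regs s r) + z)"
proof -
  have "nat \<bar>z\<bar> < 2 ^ w" "regs s r + nat \<bar>z\<bar> < 2 ^ w"
    using assms word_bounds(2) by linarith+
  then show ?thesis by (auto simp: coord_def nat_add_distrib)
qed

abbreviation small :: "int \<times> int \<Rightarrow> bool" where
  "small d \<equiv> \<bar>fst d\<bar> \<le> 4 \<and> \<bar>snd d\<bar> \<le> 4"

lemma cell_ok: "visiting v s \<Longrightarrow> small d \<Longrightarrow> bval w (cell_ok d) s \<longleftrightarrow> in_board n v d"
  by (auto simp: cell_ok_def coord_ok visiting_def env_def cells_def in_board_def)

lemma aval_cell_exp:
  assumes "visiting v s" "small d" "in_board n v d"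
  shows "aval w (cell_exp d) s = cell_index n (shift v d)"
proof -
  have "cell_index n (shift v d) < 2 ^ w"
    using cell_index_less[OF shift_in_cells[OF assms(3)]] word_bounds by simp
  \<comment> \<open>The coordinates are exact, so the wrap-arounds of product and sum merge into one
    reduction, which is void because the cell number is below \<open>2 ^ w\<close>.\<close>
  moreover have "aval w (cell_exp d) s = cell_index n (shift v d) mod 2 ^ w"
    using assms(1,2) by (auto simp: cell_exp_def aval_coord visiting_def env_def cells_def
        cell_index_def shift_def mod_simps)
  ultimately show ?thesis by simp
qed

lemma visiting_upd: "visiting v s \<Longrightarrow> 4 \<le> r \<Longrightarrow> visiting v (s\<lparr>regs := (regs s)(r := p)\<rparr>)"
  by (auto simp: visiting_def env_def)

lemma visiting_out: "visiting v s \<Longrightarrow> visiting v (s\<lparr>out := xs\<rparr>)"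
  by (auto simp: visiting_def env_def)

section \<open>Adjacency tests by list search\<close>

lemma edgeD: "{u, v} \<in> edges G \<Longrightarrow> u \<in> cells n \<and> v \<in> cells n \<and> km u v \<in> knight_moves"
  using G edge_knight_graph[of u v n] unfolding subgraph_def by blast

text \<open>\<open>km v\<close> maps the neighbours injectively into the eight knight moves.\<close>

lemma degree_le:
  assumes "distinct us" "set us = {u. {v, u} \<in> edges G}"
  shows "length us \<le> 8"
proof -
  have "km v u \<in> knight_moves" if "u \<in> set us" for u
    using that assms(2) edgeD by blast
  then have "km v ` set us \<subseteq> knight_moves" by blast
  then have "card (km v ` set us) \<le> card knight_moves"
    by (rule card_mono[rotated]) (simp add: knight_moves_def)
  moreover have "card (km v ` set us) = card (set us)"
    by (rule card_image) (auto simp: inj_on_def km_def)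
  moreover have "card knight_moves = 8"
    by (simp add: knight_moves_def)
  ultimately show ?thesis using assms(1) by (simp add: distinct_card)
qed

text \<open>Induction along the list. A round costs 24, namely 19 for the guard and 5 for following
  the pointer; the last guard test fits into 20. At the null pointer the guard still loads from
  address 0, which is harmless as memory is total.\<close>

lemma runs_search_loop:
  assumes "visiting v s" "4 \<le> r" "small e" "in_board n v e" "linked_list w m (regs s r) xs"
  shows "runs w
    (While (Conj (Neg (Equal (Reg r) (Const 0))) (Neg (Equal (Load (Reg r)) (cell_exp e))))
      (Assign r (Load (Bin Add (Reg r) (Const 1))))) s (24 * length xs + 20)
    (\<lambda>s'. \<exists>p. s' = s\<lparr>regs := (regs s)(r := p)\<rparr> \<and>
       (p \<noteq> 0 \<longleftrightarrow> cell_index n (shift v e) \<in> set xs))"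
    (is "runs w (While ?b ?c) s _ (?Q s xs)")
  using assms(1,5)
proof (induction xs arbitrary: s)
  case Nil
  \<comment> \<open>When the loop stops at once, the witness \<open>p\<close> is the present value
    of register \<open>r\<close>.\<close>
  have "s = s\<lparr>regs := (regs s)(r := regs s r)\<rparr>" by simp
  then have "?Q s [] s" using Nil.prems by (metis linked_list.simps(1) empty_iff empty_set)
  then have "runs w (While ?b ?c) s (1 + bcost ?b) (?Q s [])"
    by (intro runs_WhileFalse) (use Nil.prems in auto)
  then show ?case by (rule runs_mono) auto
next
  case (Cons x xs)
  have mem: "mem s = m" using Cons.prems(1) by (simp add: visiting_def env_def)
  have val: "aval w (cell_exp e) s = cell_index n (shift v e)"
    using aval_cell_exp Cons.prems(1) assms(3,4) by blast
  show ?case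
  proof (cases "x = cell_index n (shift v e)")
    case True
    have "s = s\<lparr>regs := (regs s)(r := regs s r)\<rparr>" by simp
    then have "?Q s (x # xs) s"
      using Cons.prems(2) True by (metis linked_list.simps(2) list.set_intros(1))
    then have "runs w (While ?b ?c) s (1 + bcost ?b) (?Q s (x # xs))"
      by (intro runs_WhileFalse) (use Cons.prems True mem val in auto)
    then show ?thesis by (rule runs_mono) auto
  next
    case False
    let ?s = "s\<lparr>regs := (regs s)(r := m (regs s r + 1))\<rparr>"
    \<comment> \<open>\<open>linked_list\<close> keeps the address of the successor field below
      \<open>2 ^ w\<close>; \<open>0 < w\<close> makes the constant 1 evaluate to 1.\<close>
    have step: "s\<lparr>regs := (regs s)(r := aval w (Load (Bin Add (Reg r) (Const 1))) s)\<rparr> = ?s"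
      using Cons.prems(2) mem word_bounds(4) by simp
    have "runs w (While ?b ?c) ?s (24 * length xs + 20) (?Q ?s xs)"
      using Cons.IH[of ?s] visiting_upd Cons.prems assms(2) by simp
    then have "runs w (While ?b ?c) ?s (24 * length xs + 20) (?Q s (x # xs))"
      by (rule runs_mono) (use False in \<open>auto simp del: fun_upd_apply\<close>)
    then have "runs w ?c s (1 + acost (Load (Bin Add (Reg r) (Const 1))))
        (\<lambda>s1. runs w (While ?b ?c) s1 (24 * length xs + 20) (?Q s (x # xs)))"
      by (intro runs_Assign) (simp only: step)
    then have "runs w (While ?b ?c) s
        (1 + bcost ?b + (1 + acost (Load (Bin Add (Reg r) (Const 1)))) + (24 * length xs + 20))
        (?Q s (x # xs))"
      by (intro runs_WhileTrue) (use Cons.prems False mem val in auto)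
    then show ?thesis by (rule runs_mono) auto
  qed
qed

text \<open>With at most 8 neighbours the cost is at most 13 + 24 * 8 + 20 = 225; the bound 300 is
  rounded up.\<close>

lemma runs_search:
  assumes vis: "visiting v s" and r: "4 \<le> r" and d: "small d" "in_board n v d"
    and e: "small e" "in_board n v e"
  shows "runs w (search r d e) s 300
    (\<lambda>s'. \<exists>p. s' = s\<lparr>regs := (regs s)(r := p)\<rparr> \<and>
       (p \<noteq> 0 \<longleftrightarrow> {shift v d, shift v e} \<in> edges G))"
proof -
  let ?u = "shift v d" and ?a = "Load (Bin Add (Reg 1) (cell_exp d))"
  have u: "?u \<in> cells n" using d shift_in_cells by blast
  then obtain us where us: "distinct us" "set us = {u. {?u, u} \<in> edges G}"
    "linked_list w m (m (b + cell_index n ?u)) (map (cell_index n) us)"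
    using adj unfolding adjacency_list_def by blast
  have "set us \<subseteq> cells n"
    using us(2) edgeD by blast
  \<comment> \<open>Cell numbers are injective on the board, so finding the number means finding the
    neighbour.\<close>
  then have mem: "cell_index n (shift v e) \<in> set (map (cell_index n) us) \<longleftrightarrow>
      {?u, shift v e} \<in> edges G"
    using inj_on_image_mem_iff[OF inj_cell_index shift_in_cells[OF e(2)], of "set us"] us(2) by simp
  have "b + cell_index n ?u < 2 ^ w"
    using adj cell_index_less[OF u] unfolding adjacency_list_def by linarith
  then have val: "aval w ?a s = m (b + cell_index n ?u)"
    using aval_cell_exp[OF vis d] vis by (simp add: visiting_def env_def)
  let ?s = "s\<lparr>regs := (regs s)(r := aval w ?a s)\<rparr>"
  have *: "runs w (search r d e) s (1 + acost ?a + (24 * length (map (cell_index n) us) + 20))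
    (\<lambda>s'. \<exists>p. s' = ?s\<lparr>regs := (regs ?s)(r := p)\<rparr> \<and>
       (p \<noteq> 0 \<longleftrightarrow> cell_index n (shift v e) \<in> set (map (cell_index n) us)))"
    unfolding search_def
    by (intro runs_Seq runs_Assign runs_search_loop visiting_upd vis r e)
      (use us(3) val in simp)
  show ?thesis
    by (rule runs_mono[OF *]) (use degree_le[OF us(1,2)] mem in auto)
qed

text \<open>Peels off a leading search and keeps of its result only whether the pointer is
  null.\<close>

lemma runs_search_Seq:
  assumes "visiting v s" "4 \<le> r" "small d" "in_board n v d" "small e" "in_board n v e"
    and "\<And>p. p \<noteq> 0 \<longleftrightarrow> {shift v d, shift v e} \<in> edges G \<Longrightarrow>
      visiting v (s\<lparr>regs := (regs s)(r := p)\<rparr>) \<Longrightarrow>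
      runs w c (s\<lparr>regs := (regs s)(r := p)\<rparr>) T Q"
  shows "runs w (Seq (search r d e) c) s (300 + T) Q"
  by (rule runs_Seq, rule runs_mono[OF runs_search[OF assms(1-6)]])
    (use assms visiting_upd in auto)

section \<open>Output and running time of the nested loops\<close>

definition found :: "cell \<Rightarrow> (int \<times> int) \<times> (int \<times> int) \<Rightarrow> (cell \<times> cell \<times> cell \<times> cell) list" where
  "found v p = (if spans_rail n G v p then [parallelogram v p] else [])"

text \<open>\<open>rs\<close> is the abstract list of quadruples behind the output words; the loop
  invariants speak about it.\<close>

definition emitted :: "(cell \<times> cell \<times> cell \<times> cell) list \<Rightarrow> state \<Rightarrow> bool" where
  "emitted rs s \<longleftrightarrow> out s = concat (map (rail_words n) rs)"

lemma emitted_regs [simp]: "emitted rs (s\<lparr>regs := f\<rparr>) \<longleftrightarrow> emitted rs s"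
  by (simp add: emitted_def)

lemma runs_try_pair:
  assumes p: "p \<in> set move_pairs" and vis: "visiting v s" and rs: "emitted rs s"
  shows "runs w (try_pair p) s 1400 (\<lambda>s'. visiting v s' \<and> emitted (rs @ found v p) s')"
proof -
  obtain d e where de: "p = (d, e)" by (cases p)
  have small: "small d" "small e" "small (d + e)" "small 0"
    using p by (auto simp: de move_pairs_def right_moves_def)
  let ?in = "in_board n v d \<and> in_board n v e \<and> in_board n v (d + e)"
  let ?E = "edges G"
  let ?Q = "\<lambda>s'. visiting v s' \<and> emitted (rs @ found v p) s'"
  let ?g = "Conj (cell_ok d) (Conj (cell_ok e) (cell_ok (d + e)))"
  have guard: "bval w ?g s \<longleftrightarrow> ?in"
    using cell_ok[OF vis] small by simp
  have v: "in_board n v 0" using vis by (simp add: visiting_def in_board_zero)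
  define c where "c = Conj (Conj (Neg (Equal (Reg 4) (Const 0))) (Neg (Equal (Reg 5) (Const 0))))
                   (Conj (Equal (Reg 6) (Const 0)) (Equal (Reg 7) (Const 0)))"
  define em where "em = Seq (Emit (cell_exp 0)) (Seq (Emit (cell_exp d))
             (Seq (Emit (cell_exp e)) (Emit (cell_exp (d + e)))))"
  \<comment> \<open>The contents of registers 4 to 7 enter only through the truth value of
    \<open>c\<close>. The 40 units pay for four outputs of cost 10.\<close>
  have emit: "runs w (If c em Skip) s' (1 + bcost c + 40) ?Q"
    if inb: ?in and at': "visiting v s'" and o': "out s' = out s"
      and c: "bval w c s' \<longleftrightarrow> spans_rail n G v p" for s'
  proof (rule runs_If)
    assume "bval w c s'"
    then have f: "found v p = [parallelogram v p]" using c by (simp add: found_def)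
    let ?i = "\<lambda>d. cell_index n (shift v d)"
    \<comment> \<open>Later outputs are evaluated in states that differ from \<open>s'\<close> in
      the output tape, hence the arbitrary \<open>xs\<close>.\<close>
    have "aval w (cell_exp a) (s'\<lparr>out := xs\<rparr>) = ?i a" if "small a" "in_board n v a" for a xs
      using aval_cell_exp[OF visiting_out[OF at'] that] .
    moreover have "aval w (cell_exp a) s' = ?i a" if "small a" "in_board n v a" for a
      using aval_cell_exp[OF at' that] .
    moreover have "?Q (s'\<lparr>out := out s' @ [?i 0, ?i d, ?i e, ?i (d + e)]\<rparr>)"
      using visiting_out[OF at'] rs o' by (simp add: emitted_def f parallelogram_def flip: de) (simp add: de)
    ultimately have "runs w em s' (1 + acost (cell_exp 0) + (1 + acost (cell_exp d) +
        (1 + acost (cell_exp e) + (1 + acost (cell_exp (d + e)))))) ?Q"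
      unfolding em_def by (intro runs_Seq runs_Emit) (use small inb v in simp)
    then show "runs w em s' 40 ?Q" by simp
  next
    assume "\<not> bval w c s'"
    then have "?Q s'" using c at' rs o' by (simp add: found_def emitted_def)
    then have "runs w Skip s' 1 ?Q" by (rule runs_Skip)
    then show "runs w Skip s' 40 ?Q" by (rule runs_mono) auto
  qed
  have searches: "runs w (Seq (search 4 0 d) (Seq (search 5 e (d + e)) (Seq (search 6 0 e)
      (Seq (search 7 d (d + e)) (If c em Skip))))) s
      (300 + (300 + (300 + (300 + (1 + bcost c + 40))))) ?Q" if inb: ?in
    by (intro runs_search_Seq[where v = v] emit)
      (use vis small inb v in \<open>auto simp: c_def spans_rail_def de\<close>)
  have "runs w (try_pair p) s (1 + bcost ?g + (1241 + bcost c)) ?Q"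
    unfolding try_pair_def Let_def de fst_conv snd_conv c_def[symmetric] em_def[symmetric]
  proof (rule runs_If)
    assume "bval w ?g s"
    then show "runs w (Seq (search 4 0 d) (Seq (search 5 e (d + e)) (Seq (search 6 0 e)
      (Seq (search 7 d (d + e)) (If c em Skip))))) s (1241 + bcost c)
      (\<lambda>s'. visiting v s' \<and> emitted (rs @ found v (d, e)) s')"
      using searches guard by (simp add: de)
  next
    assume "\<not> bval w ?g s"
    then have "found v p = []"
      using guard by (auto simp: found_def spans_rail_def de)
    then have "runs w Skip s 1 ?Q" using vis rs by (intro runs_Skip) auto
    then show "runs w Skip s (1241 + bcost c) (\<lambda>s'. visiting v s' \<and> emitted (rs @ found v (d, e)) s')"
      by (rule runs_mono) (auto simp: de)
  qed
  then show ?thesis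
    by (rule runs_mono) (use bcost_cell_ok[of d] bcost_cell_ok[of e] bcost_cell_ok[of "d + e"] in
        \<open>auto simp: c_def\<close>)
qed

definition cell_found :: "cell \<Rightarrow> (cell \<times> cell \<times> cell \<times> cell) list" where
  "cell_found v = concat (map (found v) move_pairs)"

lemma runs_visit_cell:
  assumes "visiting v s" "emitted rs s"
  shows "runs w visit_cell s 22401 (\<lambda>s'. visiting v s' \<and> emitted (rs @ cell_found v) s')"
proof -
  have "runs w visit_cell s (length move_pairs * 1400 + 1)
      (\<lambda>s'. visiting v s' \<and> emitted (rs @ cell_found v) s')"
    unfolding visit_cell_def cell_found_def
    by (rule runs_seqs[where I = "\<lambda>rs s. visiting v s \<and> emitted rs s"])
      (use assms runs_try_pair in auto)
  then show ?thesis by (simp add: move_pairs_def right_moves_def)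
qed

definition row_found :: "nat \<Rightarrow> nat \<Rightarrow> (cell \<times> cell \<times> cell \<times> cell) list" where
  "row_found i y = concat (map (\<lambda>x. cell_found (x, y)) [0..<i])"

lemma row_found_Suc: "row_found (Suc i) y = row_found i y @ cell_found (i, y)"
  by (simp add: row_found_def)

text \<open>Per cell: 22401 for the visit, 4 for the increment, 4 for the guard. The 6 are
  initialisation and the last guard test.\<close>

lemma runs_visit_row:
  assumes s: "env s" "regs s 3 = y" "y < n" "emitted rs s"
  shows "runs w visit_row s (n * 22409 + 6)
    (\<lambda>s'. env s' \<and> regs s' 3 = y \<and> emitted (rs @ row_found n y) s')"
proof -
  let ?I = "\<lambda>i s. env s \<and> regs s 2 = i \<and> regs s 3 = y \<and> emitted (rs @ row_found i y) s"
  let ?s = "s\<lparr>regs := (regs s)(2 := 0)\<rparr>"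
  have "runs w (While (Less (Reg 2) (Reg 0))
     (Seq visit_cell (Assign 2 (Bin Add (Reg 2) (Const 1))))) ?s
     ((n - 0) * (1 + bcost (Less (Reg 2) (Reg 0)) + 22405) + (1 + bcost (Less (Reg 2) (Reg 0))))
     (?I n)"
  proof (rule runs_count_up[where I = ?I])
    fix i s assume i: "i < n" and I: "?I i s"
    have vis: "visiting (i, y) s" using i I s(3) by (auto simp: visiting_def cells_def)
    have "runs w visit_cell s 22401
        (\<lambda>s1. runs w (Assign 2 (Bin Add (Reg 2) (Const 1))) s1
          (1 + acost (Bin Add (Reg 2) (Const 1))) (?I (Suc i)))"
      by (rule runs_mono[OF runs_visit_cell[OF vis, of "rs @ row_found i y"]], use I in blast, simp, rule runs_Assign)
        (use i word_bounds in \<open>auto simp: visiting_def env_def row_found_Suc\<close>)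
    from runs_Seq[OF this] show "runs w (Seq visit_cell (Assign 2 (Bin Add (Reg 2) (Const 1)))) s 22405 (?I (Suc i))"
      by (rule runs_mono) auto
  qed (use s in \<open>auto simp: env_def row_found_def\<close>)
  then have "runs w visit_row s (1 + acost (Const 0) + ((n - 0) *
      (1 + bcost (Less (Reg 2) (Reg 0)) + 22405) + (1 + bcost (Less (Reg 2) (Reg 0))))) (?I n)"
    unfolding visit_row_def by (intro runs_Seq runs_Assign) simp
  then show ?thesis by (rule runs_mono) auto
qed

definition all_found :: "nat \<Rightarrow> (cell \<times> cell \<times> cell \<times> cell) list" where
  "all_found j = concat (map (row_found n) [0..<j])"

text \<open>The 14 per row are the 6 left over from \<open>runs_visit_row\<close>, 4 for the
  increment and 4 for the guard.\<close>

lemma runs_rail_finder: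
  assumes s: "env s" "out s = []"
  shows "runs w rail_finder s (n * (n * 22409 + 14) + 6) (emitted (all_found n))"
proof -
  let ?I = "\<lambda>j s. env s \<and> regs s 3 = j \<and> emitted (all_found j) s"
  let ?s = "s\<lparr>regs := (regs s)(3 := 0)\<rparr>"
  have "runs w (While (Less (Reg 3) (Reg 0))
     (Seq visit_row (Assign 3 (Bin Add (Reg 3) (Const 1))))) ?s
     ((n - 0) * (1 + bcost (Less (Reg 3) (Reg 0)) + (n * 22409 + 10)) +
       (1 + bcost (Less (Reg 3) (Reg 0))))
     (?I n)"
  proof (rule runs_count_up[where I = ?I])
    fix j s assume j: "j < n" and I: "?I j s"
    have "runs w visit_row s (n * 22409 + 6)
        (\<lambda>s1. runs w (Assign 3 (Bin Add (Reg 3) (Const 1))) s1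
          (1 + acost (Bin Add (Reg 3) (Const 1))) (?I (Suc j)))"
      by (rule runs_mono[OF runs_visit_row[OF _ _ j, of s "all_found j"]])
        (use I in blast, use I in blast, use I in blast, simp, rule runs_Assign,
          use j word_bounds in \<open>auto simp: env_def emitted_def all_found_def\<close>)
    from runs_Seq[OF this] show "runs w (Seq visit_row (Assign 3 (Bin Add (Reg 3) (Const 1)))) s (n * 22409 + 10)
        (?I (Suc j))"
      by (rule runs_mono) auto
  qed (use s in \<open>auto simp: env_def emitted_def all_found_def\<close>)
  then have "runs w rail_finder s (1 + acost (Const 0) +
      ((n - 0) * (1 + bcost (Less (Reg 3) (Reg 0)) + (n * 22409 + 10)) +
       (1 + bcost (Less (Reg 3) (Reg 0))))) (?I n)"
    unfolding rail_finder_def by (intro runs_Seq runs_Assign) simp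
  then show ?thesis by (rule runs_mono) auto
qed

section \<open>The output as an enumeration of the rails\<close>

text \<open>The nested concatenations are one filtered product of cells and move pairs. Its elements
  are distinct, and \<open>inj_rail_of_parallelogram\<close> and \<open>rails_eq\<close> carry this
  over to the rails.\<close>

lemma encodes_all_found:
  "encodes_rails n (concat (map (rail_words n) (all_found n))) (rails n G)"
proof -
  define cs where "cs = concat (map (\<lambda>y. map (\<lambda>x. (x, y)) [0..<n]) [0..<n])"
  define L where "L = filter (\<lambda>(v, p). spans_rail n G v p) (List.product cs move_pairs)"
  have cell_found: "cell_found v = map (\<lambda>(v, p). parallelogram v p)
      (filter (\<lambda>(v, p). spans_rail n G v p) (map (Pair v) move_pairs))" for v
  proof -
    have "concat (map (found v) ps) = map (\<lambda>(v, p). parallelogram v p)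
      (filter (\<lambda>(v, p). spans_rail n G v p) (map (Pair v) ps))" for ps
      by (induction ps) (auto simp: found_def)
    then show ?thesis by (simp add: cell_found_def)
  qed
  have "concat (map cell_found vs) = map (\<lambda>(v, p). parallelogram v p)
      (filter (\<lambda>(v, p). spans_rail n G v p) (List.product vs move_pairs))" for vs
    by (induction vs) (auto simp: cell_found)
  \<comment> \<open>Only the number of rows is generalised to \<open>j\<close>, so that induction
    applies; the rows keep full length \<open>n\<close>.\<close>
  moreover have "all_found j = concat (map cell_found
      (concat (map (\<lambda>y. map (\<lambda>x. (x, y)) [0..<n]) [0..<j])))" for j
    by (induction j) (auto simp: all_found_def row_found_def comp_def)
  ultimately have L: "all_found n = map (\<lambda>(v, p). parallelogram v p) L"
    by (simp add: L_def cs_def)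
  have set_cs: "set cs = cells n" by (auto simp: cs_def cells_def)
  have set_L: "set L = {(v, p). v \<in> cells n \<and> p \<in> set move_pairs \<and> spans_rail n G v p}"
    by (auto simp: L_def set_cs)
  have "distinct cs"
  proof -
    \<comment> \<open>\<open>List.product\<close> varies the second component fastest but
      \<open>cs\<close> the column, so it is the swapped list that is a product.\<close>
    have "distinct (map prod.swap cs)"
    proof -
      have "map prod.swap cs = List.product [0..<n] [0..<n]"
        by (simp add: cs_def map_concat comp_def product_concat_map)
      then show ?thesis by (simp add: distinct_product)
    qed
    then show ?thesis by (simp add: distinct_map)
  qed
  moreover have "distinct move_pairs"
    by (simp add: move_pairs_def right_moves_def)
  ultimately have "distinct L" by (simp add: L_def distinct_product)
  have *: "map rail_of (all_found n) = map (\<lambda>(v, p). rail_of (parallelogram v p)) L"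
    by (auto simp: L)
  have "distinct (map rail_of (all_found n))"
    unfolding * distinct_map set_L using \<open>distinct L\<close> inj_rail_of_parallelogram by blast
  moreover have "set (map rail_of (all_found n)) = rails n G"
    unfolding * set_map set_L rails_eq[OF G] ..
  ultimately show ?thesis unfolding encodes_rails_def by blast
qed

end

text \<open>Program and time bound are fixed before \<open>w\<close>: any word size with room for a
  constant multiple of n^2 addresses will do.\<close>

theorem theorem2:
  "\<exists>(P :: com) (T :: nat \<Rightarrow> nat) (k :: nat).
     (\<lambda>n. real (T n)) \<in> O(\<lambda>n. real n ^ 2) \<and>
     (\<forall>(n :: nat) \<ge> 4. \<forall>G :: cell ugraph. subgraph G (knight_graph n) \<longrightarrow>
        (\<forall>w s. k * n\<^sup>2 \<le> 2 ^ w \<longrightarrow> input_state w n G s \<longrightarrow>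
           (\<exists>t s'. exec w P s t s' \<and> t \<le> T n \<and> encodes_rails n (out s') (rails n G))))"
proof (rule exI[of _ rail_finder], rule exI[of _ "\<lambda>n. n * (n * 22409 + 14) + 6"],
    rule exI[of _ 4], intro conjI allI impI)
  \<comment> \<open>For positive \<open>n\<close> both \<open>n\<close> and 1 are at most n^2, and
    22409 + 14 + 6 = 22429.\<close>
  have "n * (n * 22409 + 14) + 6 \<le> 22429 * n\<^sup>2" if "1 \<le> n" for n :: nat
  proof -
    have "n * 1 \<le> n * n" using that by (intro mult_left_mono) auto
    moreover have "1 \<le> n * n" using that by simp
    moreover have "n * (n * 22409 + 14) + 6 = 22409 * (n * n) + 14 * n + 6"
      by (simp add: algebra_simps)
    ultimately show ?thesis unfolding power2_eq_square by linarith
  qed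
  then have "real (n * (n * 22409 + 14) + 6) \<le> real (22429 * n\<^sup>2)" if "1 \<le> n" for n
    using that of_nat_le_iff by blast
  then have "norm (real (n * (n * 22409 + 14) + 6)) \<le> 22429 * norm (real n ^ 2)" if "1 \<le> n" for n
    using that by simp
  then show "(\<lambda>n. real (n * (n * 22409 + 14) + 6)) \<in> O(\<lambda>n. real n ^ 2)"
    by (intro bigoI[of _ 22429] eventually_sequentiallyI[of 1])
next
  fix n w s and G :: "cell ugraph"
  assume *: "4 \<le> n" "subgraph G (knight_graph n)" "4 * n\<^sup>2 \<le> 2 ^ w" "input_state w n G s"
  interpret rail_input w n G "mem s" "regs s 1"
    by unfold_locales (use * in \<open>auto simp: input_state_def\<close>)
  have "env s" "out s = []" using *(4) unfolding env_def input_state_def by simp_all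
  from runs_rail_finder[OF this]
  show "\<exists>t s'. exec w rail_finder s t s' \<and> t \<le> n * (n * 22409 + 14) + 6 \<and>
      encodes_rails n (out s') (rails n G)"
    unfolding runs_def emitted_def using encodes_all_found by metis
qed

end
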